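(* For any rooted graph $G^u$, where $G$ is a nontrivial connected graph, and any positive integer $n$, we have $$\dim_f(G)\leq\dim_f(G^u\sqcap P_n^0)\leq\dim_f(G^u\sqcap P_{n+1}^0)\leq\frac{|V(G)|}{2}.$$
   Context: All graphs are finite, simple and connected; the graph $G$ is nontrivial (at least two vertices). For a graph $H$, $d_H(u,v)$ is the distance between $u$ and $v$, and $R_H\{u,v\}=\{w\in V(H) : d_H(u,w)\neq d_H(v,w)\}$. For a function $g:V(H)\to[0,1]$ and $W\subseteq V(H)$ write $g(W)=\sum_{v\in W}g(v)$; the weight of $g$ is $|g|=g(V(H))$. The function $g$ is a resolving function of $H$ if $g(R_H\{u,v\})\geq 1$ for any two distinct vertices $u,v$. The fractional metric dimension $\dim_f(H)$ is the minimum weight of a resolving function of $H$. A rooted graph $G^u$ is a graph $G$ with a distinguished vertex $u$, its root. The hierarchical product $G_2^{u_2}\sqcap G_1^{u_1}$ of rooted graphs is the rooted graph with vertex set $\{x_2x_1 : x_i\in V(G_i), i=1,2\}$ (pairs), root $u_2u_1$, in which $x_2x_1$ is adjacent to $y_2y_1$ whenever $x_2=y_2$ and $\{x_1,y_1\}\in E(G_1)$, or $x_1=y_1=u_1$ and $\{x_2,y_2\}\in E(G_2)$. The fractional metric dimension of a rooted graph is that of the underlying graph. $P_n$ denotes the path on $n$ vertices $z_0=0,z_1,\ldots,z_{n-1}$ (with $z_i$ adjacent to $z_{i+1}$), and $0$ is one of its end-vertices; $P_n^0$ is $P_n$ rooted at $0$. For $n=1$, $P_1$ is a single vertex and $G^u\sqcap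 P_1^0$ is isomorphic to $G^u$. *)

theory Defs
  imports "HOL.Real" "Graph_Theory.Graph_Theory"
begin

(* A simple graph is a symmetric loop-free digraph without parallel arcs (pair_graph); an
   edge {x,y} is the pair of arcs (x,y), (y,x).  The name connected is qualified because
   Topological_Spaces has a constant of the same base name. *)
definition connected_graph :: "'a pair_pre_digraph \<Rightarrow> bool" where
  "connected_graph G \<longleftrightarrow> pair_graph G \<and> Digraph_Component.connected (with_proj G)"

definition graph_dist :: "'a pair_pre_digraph \<Rightarrow> 'a \<Rightarrow> 'a \<Rightarrow> ereal" where
  "graph_dist H u v = wf_digraph.\<mu> (with_proj H) (\<lambda>_. 1) u v"

definition resolving_set :: "'a pair_pre_digraph \<Rightarrow> 'a \<Rightarrow> 'a \<Rightarrow> 'a set" where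
  "resolving_set H u v = {w \<in> pverts H. graph_dist H u w \<noteq> graph_dist H v w}"

(* Only the values of g on the vertex set matter. *)
definition resolving_function :: "'a pair_pre_digraph \<Rightarrow> ('a \<Rightarrow> real) \<Rightarrow> bool" where
  "resolving_function H g \<longleftrightarrow>
     (\<forall>v\<in>pverts H. 0 \<le> g v \<and> g v \<le> 1) \<and>
     (\<forall>u\<in>pverts H. \<forall>v\<in>pverts H. u \<noteq> v \<longrightarrow> sum g (resolving_set H u v) \<ge> 1)"

(* LEAST on the reals denotes the minimum itself, not the infimum.  It is attained for every
   finite graph: the weight is continuous, and the resolving functions, regarded as functions
   on the vertex set, form a compact set containing the constant function 1. *)
definition frac_metric_dim :: "'a pair_pre_digraph \<Rightarrow> real" where
  "frac_metric_dim H = (LEAST r. \<exists>g. resolving_function H g \<and> r = sum g (pverts H))"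

(* the underlying graph together with its root *)
type_synonym 'a rooted_graph = "'a pair_pre_digraph \<times> 'a"

definition is_rooted_graph :: "'a rooted_graph \<Rightarrow> bool" where
  "is_rooted_graph \<G> \<longleftrightarrow> connected_graph (fst \<G>) \<and> snd \<G> \<in> pverts (fst \<G>)"

definition hierarchical_product ::
  "'a rooted_graph \<Rightarrow> 'b rooted_graph \<Rightarrow> ('a \<times> 'b) rooted_graph" (infixl \<open>\<sqinter>\<^sub>h\<close> 70) where
  "\<G>2 \<sqinter>\<^sub>h \<G>1 =
     (\<lparr> pverts = pverts (fst \<G>2) \<times> pverts (fst \<G>1),
        parcs = {((x2, x1), (y2, y1)) | x2 x1 y2 y1.
                   x2 = y2 \<and> x2 \<in> pverts (fst \<G>2) \<and> (x1, y1) \<in> parcs (fst \<G>1) \<or>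
                   x1 = snd \<G>1 \<and> y1 = snd \<G>1 \<and> (x2, y2) \<in> parcs (fst \<G>2)} \<rparr>,
      (snd \<G>2, snd \<G>1))"

definition path_graph :: "nat \<Rightarrow> nat pair_pre_digraph" where
  "path_graph n =
     \<lparr> pverts = {..<n}, parcs = {(i, j). i < n \<and> j < n \<and> (j = Suc i \<or> i = Suc j)} \<rparr>"

definition frac_metric_dim_rooted :: "'a rooted_graph \<Rightarrow> real" where
  "frac_metric_dim_rooted \<G> = frac_metric_dim (fst \<G>)"

end

theory Submission
  imports Defs "HOL-Analysis.Function_Topology"
begin

text \<open>
  A step outwards along a pendant path increases by exactly one the distance from every vertex
  that does not lie further out on the same path.  Both lower inequalities come from this one
  observation.  Let \<open>r\<close> collapse the larger graph onto the smaller one: for \<open>G\<close> inside the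
  product it is the projection to the first coordinate, and for the two products it sends the extra end layer to
  the layer before it.  A vertex \<open>w\<close> of the larger graph then distinguishes two vertices of
  the smaller graph exactly if \<open>r w\<close> does, so a resolving function can be pushed forward along \<open>r\<close>
  (\<open>frac_metric_dim_le_retract\<close>).  The weights on a fibre of \<open>r\<close> are added up and capped at 1,
  which is harmless: a vertex of weight 1 in a resolving set already satisfies the constraint.

  For the upper bound, put weight one half on the free end of every pendant path.  Two vertices in
  different copies of the path are distinguished by the ends of both copies, since the
  distance to the end of the own copy is at most the length of the path, and to the other end more.
  Two vertices of the same copy lie at different distances from its root and from its end, and so
  are distinguished by all the ends, of which there are at least two.

  Distances enter through \<open>distance_labelling\<close>, a local certificate that a function on the
  vertices is the distance to a given vertex: it vanishes there, drops by at most one along each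
  arc, and every other vertex has a neighbour that is one closer.  Such certificates for the two factors combine
  into one for the hierarchical product.  The fractional metric dimension itself is handled as an
  attained minimum, which rests on compactness of a cube.
\<close>

section \<open>The minimum weight is attained\<close>

lemma resolving_function_restrict:
  assumes "resolving_function H g"
  shows "resolving_function H (\<lambda>v. if v \<in> pverts H then g v else 0)"
proof -
  have "sum (\<lambda>v. if v \<in> pverts H then g v else 0) (resolving_set H x y)
      = sum g (resolving_set H x y)" for x y
    by (rule sum.cong) (auto simp: resolving_set_def)
  then show ?thesis
    using assms by (simp add: resolving_function_def)
qed

text \<open>
  Extending a resolving function by 0 places it in a cube, which is compact by Tychonoff; each
  constraint involves finitely many coordinates, so it cuts out a closed set.
\<close>

lemma minimum_weight_attained:
  assumes "resolving_function H g0"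
  shows "\<exists>g. resolving_function H g \<and>
    (\<forall>h. resolving_function H h \<longrightarrow> sum g (pverts H) \<le> sum h (pverts H))"
proof -
  define C where "C = PiE UNIV (\<lambda>_::'a. {0..1::real})"
  define R where "R = (\<Inter>x\<in>pverts H. \<Inter>y\<in>pverts H - {x}.
    {g::'a \<Rightarrow> real. 1 \<le> sum g (resolving_set H x y)})"
  have "compactin (product_topology (\<lambda>_::'a. euclideanreal) UNIV) C"
    unfolding C_def compactin_PiE by simp
  then have "compact C"
    by (simp add: euclidean_product_topology)
  moreover have "closed R"
    unfolding R_def
    by (intro closed_INT ballI closed_Collect_le continuous_on_sum continuous_intros
        continuous_on_product_coordinates)
  ultimately have compact: "compact (C \<inter> R)"
    by (rule compact_Int_closed)
  have into_cube: "(\<lambda>v. if v \<in> pverts H then h v else 0) \<in> C \<inter> R"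
    if "resolving_function H h" for h
    using that resolving_function_restrict[OF that]
    by (auto simp: C_def R_def resolving_function_def PiE_iff)
  have "\<exists>g\<in>C \<inter> R. \<forall>h\<in>C \<inter> R. sum g (pverts H) \<le> sum h (pverts H)"
    using into_cube[OF assms]
    by (intro continuous_attains_inf compact continuous_on_sum)
      (auto intro: continuous_on_subset[OF continuous_on_product_coordinates])
  then obtain g where g: "g \<in> C \<inter> R"
    and least: "\<And>h. h \<in> C \<inter> R \<Longrightarrow> sum g (pverts H) \<le> sum h (pverts H)"
    by blast
  have "resolving_function H g"
    using g by (auto simp: C_def R_def resolving_function_def PiE_iff)
  moreover have "sum g (pverts H) \<le> sum h (pverts H)" if "resolving_function H h" for h
    using least[OF into_cube[OF that]] by simp
  ultimately show ?thesis
    by blast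
qed

lemma frac_metric_dim_witness:
  assumes "resolving_function H g0"
  obtains g where "resolving_function H g" "frac_metric_dim H = sum g (pverts H)"
    "\<And>h. resolving_function H h \<Longrightarrow> frac_metric_dim H \<le> sum h (pverts H)"
proof -
  from minimum_weight_attained[OF assms] obtain g where g: "resolving_function H g"
    and least: "\<And>h. resolving_function H h \<Longrightarrow> sum g (pverts H) \<le> sum h (pverts H)"
    by blast
  have "frac_metric_dim H = sum g (pverts H)"
    unfolding frac_metric_dim_def using g least by (intro Least_equality) auto
  then show thesis
    using g least by (intro that[of g]) auto
qed

lemma frac_metric_dim_le:
  assumes "resolving_function H g"
  shows "frac_metric_dim H \<le> sum g (pverts H)"
  using frac_metric_dim_witness[OF assms] assms by metis

section \<open>Pushing a resolving function forward\<close>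

text \<open>
  Here \<open>r\<close> need not be a graph homomorphism; it only has to keep track of which pairs in the image
  of \<open>e\<close> a vertex distinguishes.
\<close>

lemma frac_metric_dim_le_retract:
  assumes fin: "finite (pverts H)" "finite (pverts K)"
    and ex: "resolving_function K g0"
    and r: "\<And>w. w \<in> pverts K \<Longrightarrow> r w \<in> pverts H"
    and e: "\<And>x. x \<in> pverts H \<Longrightarrow> e x \<in> pverts K" "inj_on e (pverts H)"
    and resolves: "\<And>x y w. x \<in> pverts H \<Longrightarrow> y \<in> pverts H \<Longrightarrow> w \<in> pverts K \<Longrightarrow>
      graph_dist K (e x) w \<noteq> graph_dist K (e y) w \<Longrightarrow>
      graph_dist H x (r w) \<noteq> graph_dist H y (r w)"
  shows "frac_metric_dim H \<le> frac_metric_dim K"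
proof -
  obtain g where g: "resolving_function K g" and dim: "frac_metric_dim K = sum g (pverts K)"
    using frac_metric_dim_witness[OF ex] by blast
  define F where "F v = {w \<in> pverts K. r w = v}" for v
  define h where "h v = min 1 (sum g (F v))" for v
  have g_nonneg: "0 \<le> g w" if "w \<in> pverts K" for w
    using g that by (auto simp: resolving_function_def)
  have h_nonneg: "0 \<le> h v" for v
    using g_nonneg by (auto simp: h_def F_def intro!: sum_nonneg)
  have h_resolves: "1 \<le> sum h (resolving_set H x y)"
    if x: "x \<in> pverts H" and y: "y \<in> pverts H" and "x \<noteq> y" for x y
  proof -
    let ?R = "resolving_set H x y"
    have finR: "finite ?R"
      using fin by (simp add: resolving_set_def)
    show ?thesis
    proof (cases "\<exists>v\<in>?R. h v = 1")
      case True
      then obtain v where "v \<in> ?R" "h v = 1"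
        by blast
      then show ?thesis
        using member_le_sum[of v ?R h] finR h_nonneg by simp
    next
      case False
      have "e x \<noteq> e y"
        using e(2) x y \<open>x \<noteq> y\<close> by (auto dest: inj_onD)
      then have "1 \<le> sum g (resolving_set K (e x) (e y))"
        using g e(1) x y by (auto simp: resolving_function_def)
      also have "\<dots> \<le> sum g (\<Union>v\<in>?R. F v)"
      proof (rule sum_mono2)
        show "finite (\<Union>v\<in>?R. F v)"
          using finR fin by (simp add: F_def)
        show "resolving_set K (e x) (e y) \<subseteq> (\<Union>v\<in>?R. F v)"
          using resolves[OF x y] r by (auto simp: resolving_set_def F_def)
      qed (auto simp: F_def g_nonneg)
      also have "\<dots> = (\<Sum>v\<in>?R. sum g (F v))"
        using finR fin by (intro sum.UNION_disjoint) (auto simp: F_def)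
      also have "\<dots> = sum h ?R"
        using False by (intro sum.cong refl) (auto simp: h_def min_def split: if_splits)
      finally show ?thesis .
    qed
  qed
  have "resolving_function H h"
    using h_nonneg h_resolves by (auto simp: resolving_function_def h_def)
  then have "frac_metric_dim H \<le> sum h (pverts H)"
    by (rule frac_metric_dim_le)
  also have "\<dots> \<le> (\<Sum>v\<in>pverts H. sum g (F v))"
    by (intro sum_mono) (simp add: h_def)
  also have "\<dots> = sum g (pverts K)"
    unfolding F_def using fin r by (intro sum.group) auto
  finally show ?thesis
    using dim by simp
qed

section \<open>Distance labellings\<close>

definition distance_labelling :: "'a pair_pre_digraph \<Rightarrow> 'a \<Rightarrow> ('a \<Rightarrow> nat) \<Rightarrow> bool" where
  "distance_labelling H v f \<longleftrightarrow> f v = 0 \<and>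
     (\<forall>x y. (x, y) \<in> parcs H \<longrightarrow> f x \<le> Suc (f y)) \<and>
     (\<forall>x\<in>pverts H. x \<noteq> v \<longrightarrow> (\<exists>y. (x, y) \<in> parcs H \<and> f x = Suc (f y)))"

lemma distance_labelling_eq_0_iff:
  assumes "distance_labelling H v f" "x \<in> pverts H"
  shows "f x = 0 \<longleftrightarrow> x = v"
  using assms by (auto simp: distance_labelling_def)

lemma (in wf_digraph) awalk_cost_unit: "awalk_cost (\<lambda>_. 1) p = real (length p)"
  by (induction p) simp_all

text \<open>
  The bound on the drop along arcs makes every walk to \<open>v\<close> at least as long as the label, and
  repeatedly stepping to a closer neighbour produces a walk of that length.
\<close>

lemma graph_dist_distance_labelling:
  assumes wf: "pair_wf_digraph H" and f: "distance_labelling H v f"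
    and x: "x \<in> pverts H" and v: "v \<in> pverts H"
  shows "graph_dist H x v = ereal (real (f x))"
proof -
  interpret pair_wf_digraph H by (fact wf)
  have upper: "\<exists>p. awalk x p v \<and> length p = f x" if "x \<in> pverts H" for x
    using that
  proof (induction "f x" arbitrary: x)
    case 0
    then have "x = v"
      using distance_labelling_eq_0_iff[OF f] by simp
    then show ?case
      using v 0 by (auto simp: awalk_Nil_iff intro!: exI[of _ "[]"])
  next
    case (Suc k)
    then have "x \<noteq> v"
      using f by (auto simp: distance_labelling_def)
    then obtain y where y: "(x, y) \<in> parcs H" "f x = Suc (f y)"
      using f Suc.prems by (auto simp: distance_labelling_def)
    then obtain p where "awalk y p v" "length p = f y"
      using Suc.hyps(1)[of y] Suc.hyps(2) in_arcsD2 by auto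
    then show ?case
      using y by (intro exI[of _ "(x, y) # p"]) (simp add: awalk_Cons_iff)
  qed
  have lower: "f x \<le> length p" if "awalk x p v" for x p
    using that
  proof (induction p arbitrary: x)
    case Nil
    then show ?case
      using f by (simp add: awalk_Nil_iff distance_labelling_def)
  next
    case (Cons a p)
    then have "a \<in> parcs H" "fst a = x" "f (snd a) \<le> length p"
      by (auto simp: awalk_Cons_iff)
    then show ?case
      using f by (cases a) (fastforce simp: distance_labelling_def)
  qed
  obtain p where "awalk x p v" "length p = f x"
    using upper[OF x] by blast
  then show ?thesis
    unfolding graph_dist_def \<mu>_def awalk_cost_unit
    by (intro antisym INF_greatest) (auto intro!: INF_lower2[of p] lower)
qed

lemma distance_labelling_exists:
  assumes G: "connected_graph G" and v: "v \<in> pverts G"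
  shows "\<exists>f. distance_labelling G v f"
proof -
  interpret pair_graph G
    using G by (simp add: connected_graph_def)
  define f where "f x = (LEAST k. \<exists>p. awalk x p v \<and> length p = k)" for x
  have reach: "\<exists>p. awalk x p v" if "x \<in> pverts G" for x
  proof -
    have "strongly_connected (with_proj G)"
      using G by (intro symmetric_connected_imp_strongly_connected sym_arcs)
        (simp add: connected_graph_def)
    then show ?thesis
      using that v by (auto simp: strongly_connected_def reachable_awalk)
  qed
  have shortest: "\<exists>p. awalk x p v \<and> length p = f x" if "x \<in> pverts G" for x
    unfolding f_def by (rule LeastI_ex) (use reach[OF that] in blast)
  have le: "f x \<le> length p" if "awalk x p v" for x p
    unfolding f_def by (rule Least_le) (use that in blast)
  have step: "f x \<le> Suc (f y)" if arc: "(x, y) \<in> parcs G" for x y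
  proof -
    obtain p where "awalk y p v" "length p = f y"
      using shortest[of y] in_arcsD2[OF arc] by blast
    then show ?thesis
      using le[of x "(x, y) # p"] arc by (simp add: awalk_Cons_iff)
  qed
  have "\<exists>y. (x, y) \<in> parcs G \<and> f x = Suc (f y)" if x: "x \<in> pverts G" "x \<noteq> v" for x
  proof -
    obtain p where p: "awalk x p v" "length p = f x"
      using shortest[OF x(1)] by blast
    then obtain a q where "p = a # q"
      using x(2) by (cases p) (auto simp: awalk_Nil_iff)
    then have a: "(x, snd a) \<in> parcs G" "awalk (snd a) q v" "f x = Suc (length q)"
      using p by (cases a, auto simp: awalk_Cons_iff)+
    then have "f x = Suc (f (snd a))"
      using le[OF a(2)] step[OF a(1)] by simp
    then show ?thesis
      using a(1) by blast
  qed
  moreover have "f v = 0"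
    using le[of v "[]"] v by (simp add: awalk_Nil_iff)
  ultimately have "distance_labelling G v f"
    using step by (simp add: distance_labelling_def)
  then show ?thesis
    by blast
qed

section \<open>Distances in a hierarchical product\<close>

lemma pair_wf_digraph_hierarchical_product:
  assumes "pair_wf_digraph (fst \<G>)" "pair_wf_digraph (fst \<H>)" "snd \<H> \<in> pverts (fst \<H>)"
  shows "pair_wf_digraph (fst (\<G> \<sqinter>\<^sub>h \<H>))"
  using assms by (auto simp: pair_wf_digraph_def hierarchical_product_def)

text \<open>
  A shortest route to \<open>(y, j)\<close> from another copy of \<open>\<H>\<close> goes down to the root of its copy, along
  the root layer to the copy of \<open>y\<close>, and from the root of that copy to \<open>j\<close>.
\<close>

lemma distance_labelling_hierarchical_product:
  assumes G: "distance_labelling (fst \<G>) y f"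
    and H: "distance_labelling (fst \<H>) j g" "distance_labelling (fst \<H>) (snd \<H>) h"
  shows "distance_labelling (fst (\<G> \<sqinter>\<^sub>h \<H>)) (y, j)
    (\<lambda>(x, i). if x = y then g i else h i + f x + g (snd \<H>))"
    (is "distance_labelling _ _ ?F")
proof -
  have "\<exists>q. (p, q) \<in> parcs (fst (\<G> \<sqinter>\<^sub>h \<H>)) \<and> ?F p = Suc (?F q)"
    if p: "p \<in> pverts (fst (\<G> \<sqinter>\<^sub>h \<H>))" "p \<noteq> (y, j)" for p
  proof -
    obtain x i where xi: "p = (x, i)" "x \<in> pverts (fst \<G>)" "i \<in> pverts (fst \<H>)"
      using p(1) by (auto simp: hierarchical_product_def)
    consider "x = y" "i \<noteq> j" | "x \<noteq> y" "i \<noteq> snd \<H>" | "x \<noteq> y" "i = snd \<H>"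
      using p(2) xi(1) by blast
    then show ?thesis
    proof cases
      case 1
      then obtain k where "(i, k) \<in> parcs (fst \<H>)" "g i = Suc (g k)"
        using H(1) xi by (auto simp: distance_labelling_def)
      then show ?thesis
        using 1 xi by (intro exI[of _ "(x, k)"]) (auto simp: hierarchical_product_def)
    next
      case 2
      then obtain k where "(i, k) \<in> parcs (fst \<H>)" "h i = Suc (h k)"
        using H(2) xi by (auto simp: distance_labelling_def)
      then show ?thesis
        using 2 xi by (intro exI[of _ "(x, k)"]) (auto simp: hierarchical_product_def)
    next
      case 3
      then obtain z where "(x, z) \<in> parcs (fst \<G>)" "f x = Suc (f z)"
        using G xi by (auto simp: distance_labelling_def)
      then show ?thesis
        using 3 xi G H(2)
        by (intro exI[of _ "(z, i)"]) (auto simp: hierarchical_product_def distance_labelling_def)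
    qed
  qed
  moreover have "?F p \<le> Suc (?F q)" if "(p, q) \<in> parcs (fst (\<G> \<sqinter>\<^sub>h \<H>))" for p q
  proof -
    from that consider x i k where "p = (x, i)" "q = (x, k)" "(i, k) \<in> parcs (fst \<H>)"
      | x z where "p = (x, snd \<H>)" "q = (z, snd \<H>)" "(x, z) \<in> parcs (fst \<G>)"
      by (cases p; cases q) (auto simp: hierarchical_product_def)
    then show ?thesis
    proof cases
      case 1
      then show ?thesis
        using H by (auto simp: distance_labelling_def)
    next
      case 2
      then have "f x \<le> Suc (f z)" "h (snd \<H>) = 0" "f y = 0"
        using G H(2) by (auto simp: distance_labelling_def)
      then show ?thesis
        using 2 by auto
    qed
  qed
  ultimately show ?thesis
    using H(1) by (simp add: distance_labelling_def)
qed

lemma distance_labelling_path_graph: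
  assumes "j < m"
  shows "distance_labelling (path_graph m) j (\<lambda>i. (i - j) + (j - i))"
proof -
  have "\<exists>k. (i, k) \<in> parcs (path_graph m) \<and> (i - j) + (j - i) = Suc ((k - j) + (j - k))"
    if "i < m" "i \<noteq> j" for i
    using that assms
    by (intro exI[of _ "if i < j then Suc i else i - 1"]) (auto simp: path_graph_def)
  then show ?thesis
    by (auto simp: distance_labelling_def path_graph_def)
qed

lemma pverts_path_product:
  "pverts (fst ((G, u) \<sqinter>\<^sub>h (path_graph m, 0))) = pverts G \<times> {..<m}"
  by (simp add: hierarchical_product_def path_graph_def)

text \<open>
  The single function \<open>d\<close> serves all path lengths, so that distances in products with different
  paths can be compared; being integer valued it also avoids extended arithmetic.
\<close>

lemma path_product_distances:
  assumes G: "connected_graph G"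
  obtains d :: "'a \<Rightarrow> 'a \<Rightarrow> nat" where
    "\<And>x y. x \<in> pverts G \<Longrightarrow> y \<in> pverts G \<Longrightarrow> graph_dist G x y = ereal (real (d x y))"
    "\<And>x y. x \<in> pverts G \<Longrightarrow> y \<in> pverts G \<Longrightarrow> d x y = 0 \<longleftrightarrow> x = y"
    "\<And>m x y i j. x \<in> pverts G \<Longrightarrow> y \<in> pverts G \<Longrightarrow> i < m \<Longrightarrow> j < m \<Longrightarrow>
      graph_dist (fst ((G, u) \<sqinter>\<^sub>h (path_graph m, 0))) (x, i) (y, j) =
        ereal (real (if x = y then (i - j) + (j - i) else i + d x y + j))"
proof -
  have wf: "pair_wf_digraph G"
    using G by (auto simp: connected_graph_def pair_graph_def pair_digraph_def pair_fin_digraph_def)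
  obtain f where f: "\<And>y. y \<in> pverts G \<Longrightarrow> distance_labelling G y (f y)"
    using distance_labelling_exists[OF G] by metis
  show thesis
  proof (rule that[of "\<lambda>x y. f y x"])
    fix x y assume xy: "x \<in> pverts G" "y \<in> pverts G"
    show "graph_dist G x y = ereal (real (f y x))"
      by (rule graph_dist_distance_labelling[OF wf f]) (use xy in auto)
    show "f y x = 0 \<longleftrightarrow> x = y"
      by (rule distance_labelling_eq_0_iff[OF f]) (use xy in auto)
    fix m i j :: nat assume ij: "i < m" "j < m"
    let ?P = "fst ((G, u) \<sqinter>\<^sub>h (path_graph m, 0))"
    have wfP: "pair_wf_digraph ?P"
      using wf ij(1)
      by (intro pair_wf_digraph_hierarchical_product)
        (auto simp: pair_wf_digraph_def path_graph_def)
    \<comment> \<open>The summands with a zero are instances of the path labelling, for the end \<open>0\<close> as target.\<close>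
    have "distance_labelling ?P (y, j)
        (\<lambda>(x, i). if x = y then (i - j) + (j - i)
          else ((i - 0) + (0 - i)) + f y x + ((0 - j) + (j - 0)))"
      using distance_labelling_hierarchical_product[of "(G, u)" y "f y" "(path_graph m, 0)" j
          "\<lambda>i. (i - j) + (j - i)" "\<lambda>i. (i - 0) + (0 - i)",
          unfolded fst_conv snd_conv]
        f[OF xy(2)] distance_labelling_path_graph[of j m] distance_labelling_path_graph[of 0 m] ij
      by simp
    from graph_dist_distance_labelling[OF wfP this, of "(x, i)"]
    show "graph_dist ?P (x, i) (y, j) =
        ereal (real (if x = y then (i - j) + (j - i) else i + f y x + j))"
      using xy ij by (simp add: pverts_path_product)
  qed
qed

section \<open>Comparing the dimensions\<close>

text \<open>
  The bound on the cardinality serves the pairs in one copy of the path: all the ends resolve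
  them, and together the ends then have weight at least 1.  The case \<open>k = 0\<close>, in which the end is
  the root itself, makes this also the feasible point from which the minimum is known to exist.
\<close>

lemma half_on_path_ends_resolving:
  assumes G: "connected_graph G" and card: "2 \<le> card (pverts G)"
  shows "resolving_function (fst ((G, u) \<sqinter>\<^sub>h (path_graph (Suc k), 0)))
    (\<lambda>(x, i). if i = k then 1 / 2 else 0)"
    (is "resolving_function _ ?g")
proof -
  let ?P = "\<lambda>m. fst ((G, u) \<sqinter>\<^sub>h (path_graph m, 0::nat))"
  obtain d where "\<And>x y. x \<in> pverts G \<Longrightarrow> y \<in> pverts G \<Longrightarrow>
      graph_dist G x y = ereal (real (d x y))"
    and d: "\<And>x y. x \<in> pverts G \<Longrightarrow> y \<in> pverts G \<Longrightarrow> d x y = 0 \<longleftrightarrow> x = y"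
    and dist: "\<And>m x y i j. x \<in> pverts G \<Longrightarrow> y \<in> pverts G \<Longrightarrow> i < m \<Longrightarrow> j < m \<Longrightarrow>
      graph_dist (?P m) (x, i) (y, j) =
        ereal (real (if x = y then (i - j) + (j - i) else i + d x y + j))"
    by (rule path_product_distances[OF G, of u]) (rule that)
  have fin: "finite (pverts G)"
    using card by (intro card_ge_0_finite) simp
  have enough: "1 \<le> sum ?g (resolving_set (?P (Suc k)) p q)"
    if S: "S \<subseteq> pverts G" "2 \<le> card S" "S \<times> {k} \<subseteq> resolving_set (?P (Suc k)) p q" for S p q
  proof -
    have "1 \<le> real (card S) / 2"
      using S(2) by simp
    also have "\<dots> = sum ?g (S \<times> {k})"
      by (simp add: sum.cartesian_product[symmetric])
    also have "\<dots> \<le> sum ?g (resolving_set (?P (Suc k)) p q)"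
      using S(3) fin by (intro sum_mono2) (auto simp: resolving_set_def pverts_path_product split: if_splits)
    finally show ?thesis .
  qed
  have "1 \<le> sum ?g (resolving_set (?P (Suc k)) (x, i) (y, j))"
    if V: "x \<in> pverts G" "y \<in> pverts G" "i < Suc k" "j < Suc k" and ne: "(x, i) \<noteq> (y, j)"
    for x y i j
  proof (cases "x = y")
    case True
    then have "pverts G \<times> {k} \<subseteq> resolving_set (?P (Suc k)) (x, i) (y, j)"
      using V ne dist by (auto simp: resolving_set_def pverts_path_product split: if_splits)
    then show ?thesis
      by (rule enough[OF order.refl card])
  next
    case False
    then have "d x y \<noteq> 0" "d y x \<noteq> 0"
      using d V by auto
    then have "{x, y} \<times> {k} \<subseteq> resolving_set (?P (Suc k)) (x, i) (y, j)"
      using V False dist by (auto simp: resolving_set_def pverts_path_product)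
    then show ?thesis
      using V False by (intro enough[of "{x, y}"]) auto
  qed
  then show ?thesis
    by (auto simp: resolving_function_def pverts_path_product)
qed

theorem proposition3p5:
  fixes G :: "'a pair_pre_digraph" and u :: 'a and n :: nat
  assumes "is_rooted_graph (G, u)"
    and "card (pverts G) \<ge> 2"
    and "n \<ge> 1"
  shows "frac_metric_dim G \<le> frac_metric_dim_rooted ((G, u) \<sqinter>\<^sub>h (path_graph n, 0)) \<and>
    frac_metric_dim_rooted ((G, u) \<sqinter>\<^sub>h (path_graph n, 0))
      \<le> frac_metric_dim_rooted ((G, u) \<sqinter>\<^sub>h (path_graph (n + 1), 0)) \<and>
    frac_metric_dim_rooted ((G, u) \<sqinter>\<^sub>h (path_graph (n + 1), 0))
      \<le> real (card (pverts G)) / 2"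
proof (intro conjI)
  let ?P = "\<lambda>m. fst ((G, u) \<sqinter>\<^sub>h (path_graph m, 0::nat))"
  have G: "connected_graph G"
    using assms(1) by (simp add: is_rooted_graph_def)
  have fin: "finite (pverts G)"
    using assms(2) by (intro card_ge_0_finite) simp
  obtain d where distG: "\<And>x y. x \<in> pverts G \<Longrightarrow> y \<in> pverts G \<Longrightarrow>
      graph_dist G x y = ereal (real (d x y))"
    and d: "\<And>x y. x \<in> pverts G \<Longrightarrow> y \<in> pverts G \<Longrightarrow> d x y = 0 \<longleftrightarrow> x = y"
    and dist: "\<And>m x y i j. x \<in> pverts G \<Longrightarrow> y \<in> pverts G \<Longrightarrow> i < m \<Longrightarrow> j < m \<Longrightarrow>
      graph_dist (?P m) (x, i) (y, j) =
        ereal (real (if x = y then (i - j) + (j - i) else i + d x y + j))"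
    by (rule path_product_distances[OF G, of u]) (rule that)
  have d_self: "d x x = 0" if "x \<in> pverts G" for x
    using d that by simp
  obtain k where n: "n = Suc k"
    using assms(3) by (cases n) auto
  note half = half_on_path_ends_resolving[OF G assms(2), of u]

  show "frac_metric_dim G \<le> frac_metric_dim_rooted ((G, u) \<sqinter>\<^sub>h (path_graph n, 0))"
    unfolding frac_metric_dim_rooted_def n
  proof (rule frac_metric_dim_le_retract[where r = fst and e = "\<lambda>x. (x, 0)", OF fin _ half[of k]])
    fix x y w
    assume "x \<in> pverts G" "y \<in> pverts G" "w \<in> pverts (?P (Suc k))"
      "graph_dist (?P (Suc k)) (x, 0) w \<noteq> graph_dist (?P (Suc k)) (y, 0) w"
    then show "graph_dist G x (fst w) \<noteq> graph_dist G y (fst w)"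
      by (cases w) (auto simp: pverts_path_product dist distG d_self d split: if_splits)
  qed (auto simp: pverts_path_product fin inj_on_def)

  let ?r = "\<lambda>(x, i). (x, min i k)"
  show "frac_metric_dim_rooted ((G, u) \<sqinter>\<^sub>h (path_graph n, 0))
      \<le> frac_metric_dim_rooted ((G, u) \<sqinter>\<^sub>h (path_graph (n + 1), 0))"
    unfolding frac_metric_dim_rooted_def n Suc_eq_plus1[symmetric]
  proof (rule frac_metric_dim_le_retract[where r = ?r and e = "\<lambda>p. p", OF _ _ half[of "Suc k"]])
    fix p q w
    assume V: "p \<in> pverts (?P (Suc k))" "q \<in> pverts (?P (Suc k))" "w \<in> pverts (?P (Suc (Suc k)))"
      and "graph_dist (?P (Suc (Suc k))) p w \<noteq> graph_dist (?P (Suc (Suc k))) q w"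
    \<comment> \<open>The layer \<open>Suc k\<close> is one step beyond the layer \<open>k\<close> as seen from every vertex of the
      smaller product.\<close>
    moreover have "graph_dist (?P (Suc (Suc k))) p w =
        graph_dist (?P (Suc k)) p (?r w) + ereal (real (snd w - k))"
      if "p \<in> pverts (?P (Suc k))" for p
      using that V(3) by (cases p; cases w) (auto simp: pverts_path_product dist min_def)
    ultimately show "graph_dist (?P (Suc k)) p (?r w) \<noteq> graph_dist (?P (Suc k)) q (?r w)"
      by auto
  qed (auto simp: pverts_path_product fin)

  have "frac_metric_dim (?P (Suc n)) \<le> sum (\<lambda>(x, i). if i = n then 1 / 2 else 0) (pverts (?P (Suc n)))"
    by (rule frac_metric_dim_le[OF half])
  also have "\<dots> = real (card (pverts G)) / 2"
    by (simp add: pverts_path_product sum.cartesian_product[symmetric])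
  finally show "frac_metric_dim_rooted ((G, u) \<sqinter>\<^sub>h (path_graph (n + 1), 0))
      \<le> real (card (pverts G)) / 2"
    by (simp add: frac_metric_dim_rooted_def)
qed

end
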